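(* There is a $\Sigma^0_1$ preorder $\langle\omega,R\rangle$ which is not isomorphic to any $\Pi^0_1$ preorder.
   Context: A preorder is a structure $\langle \omega, R\rangle$ where $R\subseteq\omega^2$ is a reflexive and transitive relation on $\omega$ (the domain is always $\omega$). It is called a $\Sigma^0_1$ (resp. $\Pi^0_1$) preorder if the relation $R$ itself, viewed as a subset of $\omega^2$, is computably enumerable (resp. co-computably enumerable). The preorder is considered as the structure $\langle\omega,R\rangle$ itself, not as the quotient partial order by the induced equivalence; isomorphism means isomorphism of the structures $\langle\omega,R\rangle$. *)

theory Defs
  imports Main
begin

text \<open>
  Kleene's partial recursive functions, as programs acting on argument lists. A program carries
  no arity: for each \<open>k\<close>, restricting it to lists of length \<open>k\<close> gives a \<open>k\<close>-ary partial recursive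
  function (which is undefined wherever the argument list is too short for the program), and every
  \<open>k\<close>-ary partial recursive function arises in this way.
\<close>

datatype recf =
    Zero
  | Succ
  | Proj nat
  | Comp recf "recf list"
  | PrimRec recf recf
  | Mu recf

text \<open>
  \<open>computes f xs y\<close>: the program \<open>f\<close> halts on the arguments \<open>xs\<close> with result \<open>y\<close>.
  Recursion is on the first argument; \<open>Mu f\<close> searches for the least zero of \<open>f\<close> in its first argument
  and diverges if some earlier value of \<open>f\<close> is undefined.
\<close>

inductive computes :: "recf \<Rightarrow> nat list \<Rightarrow> nat \<Rightarrow> bool" where
  Zero: "computes Zero xs 0"
| Succ: "computes Succ (x # xs) (Suc x)"
| Proj: "i < length xs \<Longrightarrow> computes (Proj i) xs (xs ! i)"
| Comp: "list_all2 (\<lambda>g y. computes g xs y) gs ys \<Longrightarrow> computes f ys z \<Longrightarrow> computes (Comp f gs) xs z"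
| PrimRec_0: "computes f xs y \<Longrightarrow> computes (PrimRec f g) (0 # xs) y"
| PrimRec_Suc: "computes (PrimRec f g) (n # xs) y \<Longrightarrow> computes g (n # y # xs) z \<Longrightarrow>
    computes (PrimRec f g) (Suc n # xs) z"
| Mu: "computes f (n # xs) 0 \<Longrightarrow> (\<And>m. m < n \<Longrightarrow> \<exists>y>0. computes f (m # xs) y) \<Longrightarrow>
    computes (Mu f) xs n"

lemma computes_deterministic: "computes f xs y \<Longrightarrow> computes f xs z \<Longrightarrow> y = z"
proof (induction arbitrary: z rule: computes.induct)
  case (Zero xs)
  then show ?case by cases simp
next
  case (Succ x xs)
  then show ?case by cases simp
next
  case (Proj i xs)
  from Proj.prems show ?case by cases simp
next
  case (Comp xs gs ys f w)
  from Comp.prems obtain ys' where ys': "list_all2 (\<lambda>g y. computes g xs y) gs ys'"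
    and f: "computes f ys' z"
    by cases blast
  have "ys = ys'"
    using Comp.IH(1) ys' by (simp add: list_all2_conv_all_nth list_eq_iff_nth_eq)
  with f Comp.IH(2) show ?case by blast
next
  case (PrimRec_0 f xs y g)
  from PrimRec_0.prems have "computes f xs z" by cases simp_all
  with PrimRec_0.IH show ?case by blast
next
  case (PrimRec_Suc f g n xs y w)
  from PrimRec_Suc.prems obtain y' where "computes (PrimRec f g) (n # xs) y'"
    and "computes g (n # y' # xs) z"
    by cases simp_all
  with PrimRec_Suc.IH show ?case by blast
next
  case (Mu f n xs)
  from Mu.prems have z: "computes f (z # xs) 0"
    and below: "\<And>m. m < z \<Longrightarrow> \<exists>y>0. computes f (m # xs) y"
    by (cases, blast)+
  have "\<not> n < z" using below[of n] Mu.IH(1) by blast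
  moreover have "\<not> z < n" using Mu.IH(2)[of z] z by blast
  ultimately show ?case by simp
qed

definition ce :: "nat rel \<Rightarrow> bool" where
  "ce R \<longleftrightarrow> (\<exists>f. \<forall>x y. (x, y) \<in> R \<longleftrightarrow> (\<exists>z. computes f [x, y] z))"

definition co_ce :: "nat rel \<Rightarrow> bool" where
  "co_ce R \<longleftrightarrow> ce (- R)"

definition Sigma01_preorder :: "nat rel \<Rightarrow> bool" where
  "Sigma01_preorder R \<longleftrightarrow> preorder_on UNIV R \<and> ce R"

definition Pi01_preorder :: "nat rel \<Rightarrow> bool" where
  "Pi01_preorder R \<longleftrightarrow> preorder_on UNIV R \<and> co_ce R"

definition isomorphic :: "nat rel \<Rightarrow> nat rel \<Rightarrow> bool" where
  "isomorphic R S \<longleftrightarrow> (\<exists>h. bij h \<and> (\<forall>x y. (x, y) \<in> R \<longleftrightarrow> (h x, h y) \<in> S))"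

end

theory Submission imports Defs "HOL-Library.Nat_Bijection" begin

text \<open>
  Arrange \<open>\<omega>\<close> in consecutive pairs \<open>P\<^sub>0, P\<^sub>1, \<dots>\<close>, put \<open>P\<^sub>i\<close> below \<open>P\<^sub>j\<close> exactly when \<open>i + 2 \<le> j\<close>,
  and make the two elements of \<open>P\<^sub>n\<close> equivalent once \<open>n\<close> enters the halting set, leaving them
  incomparable otherwise. In a \<open>\<Pi>\<^sup>0\<^sub>1\<close> copy incomparability is c.e., and \<open>P\<^bsub>n+2\<^esub>\<close> consists of the
  elements outside \<open>P\<^sub>n \<union> P\<^bsub>n+1\<^esub>\<close> which are incomparable to a given element of \<open>P\<^bsub>n+1\<^esub>\<close>. So from
  \<open>P\<^sub>0\<close> and \<open>P\<^sub>1\<close> one can compute all the pairs of the copy as unordered pairs, which makes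
  incomparability within \<open>P\<^sub>n\<close>, that is, the complement of the halting set, c.e.
\<close>

section \<open>Total recursive functions and decidable relations\<close>

text \<open>Programs carry no arity, so values are prescribed only on lists of length
  \<open>k\<close>. Functions of the whole list let the closure rules apply backwards to any
  expression in \<open>xs\<close>.\<close>

definition recursive :: "nat \<Rightarrow> (nat list \<Rightarrow> nat) \<Rightarrow> bool" where
  "recursive k F \<longleftrightarrow> (\<exists>p. \<forall>xs. length xs = k \<longrightarrow> computes p xs (F xs))"

definition decidable :: "nat \<Rightarrow> (nat list \<Rightarrow> bool) \<Rightarrow> bool" where
  "decidable k P \<longleftrightarrow> recursive k (\<lambda>xs. of_bool (P xs))"

lemma recursiveI: "(\<And>xs. length xs = k \<Longrightarrow> computes p xs (F xs)) \<Longrightarrow> recursive k F"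
  unfolding recursive_def by blast

lemma recursive_cong: "recursive k F \<Longrightarrow> (\<And>xs. length xs = k \<Longrightarrow> F xs = G xs) \<Longrightarrow> recursive k G"
  unfolding recursive_def by metis

lemma decidable_cong:
  "decidable k P \<Longrightarrow> (\<And>xs. length xs = k \<Longrightarrow> P xs \<longleftrightarrow> Q xs) \<Longrightarrow> decidable k Q"
  unfolding decidable_def by (erule recursive_cong) simp

lemma recursive_nth: "i < k \<Longrightarrow> recursive k (\<lambda>xs. xs ! i)"
  by (rule recursiveI[where p = "Proj i"]) (simp add: computes.Proj)

lemma recursive_compose:
  assumes "recursive (length Fs) G" and "\<And>F. F \<in> set Fs \<Longrightarrow> recursive k F"
  shows "recursive k (\<lambda>xs. G (map (\<lambda>F. F xs) Fs))"
proof -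
  obtain p where p: "\<And>ys. length ys = length Fs \<Longrightarrow> computes p ys (G ys)"
    using assms(1) unfolding recursive_def by blast
  have "\<forall>F\<in>set Fs. \<exists>q. \<forall>xs. length xs = k \<longrightarrow> computes q xs (F xs)"
    using assms(2) unfolding recursive_def by blast
  then obtain q where q: "\<And>F xs. F \<in> set Fs \<Longrightarrow> length xs = k \<Longrightarrow> computes (q F) xs (F xs)"
    by metis
  show ?thesis
  proof (rule recursiveI)
    fix xs :: "nat list" assume xs: "length xs = k"
    have "list_all2 (\<lambda>g y. computes g xs y) (map q Fs) (map (\<lambda>F. F xs) Fs)"
      using q xs by (simp add: list_all2_conv_all_nth)
    then show "computes (Comp p (map q Fs)) xs (G (map (\<lambda>F. F xs) Fs))"
      by (rule computes.Comp) (simp add: p)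
  qed
qed

lemma recursive_select:
  assumes "recursive m F" and "\<And>i. i < m \<Longrightarrow> j i < k"
  shows "recursive k (\<lambda>xs. F (map (\<lambda>i. xs ! j i) [0..<m]))"
proof -
  let ?Fs = "map (\<lambda>i xs. xs ! j i) [0..<m]"
  have "recursive k (\<lambda>xs. F (map (\<lambda>G. G xs) ?Fs))"
    using assms by (intro recursive_compose) (auto intro: recursive_nth)
  then show ?thesis by (simp add: comp_def)
qed

text \<open>Each bounded quantifier turns its variable into \<open>hd\<close> and the old list into
  \<open>tl\<close>; these forms cover two nested quantifiers.\<close>

lemma recursive_hd: "0 < k \<Longrightarrow> recursive k (\<lambda>xs. hd xs)"
  by (rule recursive_cong[OF recursive_nth[of 0]]) (auto simp: hd_conv_nth)

lemma recursive_tl_nth: "Suc i < k \<Longrightarrow> recursive k (\<lambda>xs. tl xs ! i)"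
  by (rule recursive_cong[OF recursive_nth[of "Suc i"]]) (auto simp: nth_tl)

lemma recursive_hd_tl: "Suc 0 < k \<Longrightarrow> recursive k (\<lambda>xs. hd (tl xs))"
  by (rule recursive_cong[OF recursive_nth[of "Suc 0"]])
    (auto simp: neq_Nil_conv Suc_less_eq2 length_Suc_conv)

lemma recursive_tl_tl_nth: "Suc (Suc i) < k \<Longrightarrow> recursive k (\<lambda>xs. tl (tl xs) ! i)"
  by (rule recursive_cong[OF recursive_nth[of "Suc (Suc i)"]]) (auto simp: nth_tl)

lemmas recursive_vars =
  recursive_nth recursive_hd recursive_tl_nth recursive_hd_tl recursive_tl_tl_nth

lemma recursive_apply:
  assumes "recursive (Suc k) F" and "recursive k B"
  shows "recursive k (\<lambda>xs. F (B xs # xs))"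
proof -
  let ?Fs = "B # map (\<lambda>i xs. xs ! i) [0..<k]"
  have "recursive k (\<lambda>xs. F (map (\<lambda>G. G xs) ?Fs))"
    using assms by (intro recursive_compose) (auto intro: recursive_nth)
  then show ?thesis
    by (rule recursive_cong) (auto simp: comp_def map_nth intro!: arg_cong[of _ _ F])
qed

lemma recursive_unary:
  assumes "recursive 1 (\<lambda>xs. f (xs ! 0))" and "recursive k F"
  shows "recursive k (\<lambda>xs. f (F xs))"
  using recursive_compose[of "[F]" "\<lambda>xs. f (xs ! 0)" k] assms by simp

lemma recursive_binary:
  assumes "recursive 2 (\<lambda>xs. f (xs ! 0) (xs ! 1))" and "recursive k F" and "recursive k G"
  shows "recursive k (\<lambda>xs. f (F xs) (G xs))"
  using recursive_compose[of "[F, G]" "\<lambda>xs. f (xs ! 0) (xs ! 1)" k] assms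
  by (auto simp: numeral_2_eq_2)

lemma recursive_Suc:
  assumes "recursive k F"
  shows "recursive k (\<lambda>xs. Suc (F xs))"
proof (rule recursive_unary[OF _ assms], rule recursiveI)
  fix xs :: "nat list" assume "length xs = 1"
  then obtain x where "xs = [x]" by (auto simp: length_Suc_conv)
  then show "computes Succ xs (Suc (xs ! 0))" by (simp add: computes.Succ)
qed

lemma recursive_const: "recursive k (\<lambda>xs. c)"
proof (induction c)
  case 0
  show ?case by (rule recursiveI) (rule computes.Zero)
next
  case (Suc c)
  then show ?case by (rule recursive_Suc)
qed

lemma recursive_rec_nat:
  assumes "recursive k B" and "recursive (Suc (Suc k)) G"
  shows "recursive (Suc k) (\<lambda>xs. rec_nat (B (tl xs)) (\<lambda>n y. G (n # y # tl xs)) (hd xs))"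
proof -
  obtain p where p: "\<And>xs. length xs = k \<Longrightarrow> computes p xs (B xs)"
    using assms(1) unfolding recursive_def by blast
  obtain q where q: "\<And>xs. length xs = Suc (Suc k) \<Longrightarrow> computes q xs (G xs)"
    using assms(2) unfolding recursive_def by blast
  have "computes (PrimRec p q) (n # xs) (rec_nat (B xs) (\<lambda>n y. G (n # y # xs)) n)"
    if "length xs = k" for n xs
    by (induction n) (auto intro!: computes.PrimRec_0 p computes.PrimRec_Suc q that)
  then show ?thesis
    by (intro recursiveI[where p = "PrimRec p q"]) (auto simp: length_Suc_conv)
qed

lemma recursive_rec_nat_binary:
  assumes "recursive 1 (\<lambda>xs. b (xs ! 0))"
    and "recursive 3 (\<lambda>xs. g (xs ! 0) (xs ! 1) (xs ! 2))"
    and "\<And>x. f 0 x = b x" and "\<And>n x. f (Suc n) x = g n (f n x) x"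
  shows "recursive 2 (\<lambda>xs. f (xs ! 0) (xs ! 1))"
proof -
  have eq: "f n x = rec_nat (b x) (\<lambda>n y. g n y x) n" for n x
    by (induction n) (simp_all add: assms)
  have "recursive (Suc (Suc 0)) (\<lambda>xs. rec_nat (b (tl xs ! 0))
      (\<lambda>n y. g ((n # y # tl xs) ! 0) ((n # y # tl xs) ! 1) ((n # y # tl xs) ! 2)) (hd xs))"
    using assms(1,2)
    by (intro recursive_rec_nat[where B = "\<lambda>xs. b (xs ! 0)"
          and G = "\<lambda>xs. g (xs ! 0) (xs ! 1) (xs ! 2)"]) (simp_all add: numeral_3_eq_3)
  then have "recursive (Suc (Suc 0)) (\<lambda>xs. f (xs ! 0) (xs ! 1))"
    by (rule recursive_cong) (auto simp: eq length_Suc_conv)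
  then show ?thesis by (simp add: numeral_2_eq_2)
qed

section \<open>Arithmetic functions\<close>

lemma recursive_add:
  assumes "recursive k F" and "recursive k G"
  shows "recursive k (\<lambda>xs. F xs + G xs)"
  by (rule recursive_binary[OF _ assms, of "(+)"],
      rule recursive_rec_nat_binary[where b = "\<lambda>x. x" and g = "\<lambda>n y x. Suc y"])
    (auto intro!: recursive_vars recursive_Suc)

lemma recursive_mult:
  assumes "recursive k F" and "recursive k G"
  shows "recursive k (\<lambda>xs. F xs * G xs)"
  by (rule recursive_binary[OF _ assms, of "(*)"],
      rule recursive_rec_nat_binary[where b = "\<lambda>x. 0" and g = "\<lambda>n y x. x + y"])
    (auto intro!: recursive_vars recursive_const recursive_add)

lemma recursive_pred:
  assumes "recursive k F"
  shows "recursive k (\<lambda>xs. F xs - 1)"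
proof -
  \<comment> \<open>The recursion rule is for binary functions, so a dummy second argument is
    supplied.\<close>
  have "recursive k (\<lambda>xs. (\<lambda>x y. x - 1) (F xs) (F xs))"
    by (rule recursive_binary[OF _ assms assms, of "\<lambda>x y. x - 1"],
        rule recursive_rec_nat_binary[where b = "\<lambda>x. 0" and g = "\<lambda>n y x. n"])
      (auto intro!: recursive_vars recursive_const)
  then show ?thesis by simp
qed

lemma recursive_diff:
  assumes "recursive k F" and "recursive k G"
  shows "recursive k (\<lambda>xs. F xs - G xs)"
  \<comment> \<open>The recursion runs on the subtrahend, hence the swapped arguments.\<close>
  by (rule recursive_binary[OF _ assms(2,1), of "\<lambda>y x. x - y"],
      rule recursive_rec_nat_binary[where b = "\<lambda>x. x" and g = "\<lambda>n y x. y - 1"])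
    (auto intro!: recursive_vars recursive_pred simp del: One_nat_def)

lemma recursive_power2:
  assumes "recursive k F"
  shows "recursive k (\<lambda>xs. 2 ^ F xs)"
proof -
  have "recursive k (\<lambda>xs. (\<lambda>x y. 2 ^ x) (F xs) (F xs))"
    by (rule recursive_binary[OF _ assms assms, of "\<lambda>x y. 2 ^ x"],
        rule recursive_rec_nat_binary[where b = "\<lambda>x. 1" and g = "\<lambda>n y x. 2 * y"])
      (auto intro!: recursive_vars recursive_mult recursive_const)
  then show ?thesis by simp
qed

section \<open>Decidable relations and unbounded search\<close>

lemma decidable_less:
  assumes "recursive k F" and "recursive k G"
  shows "decidable k (\<lambda>xs. F xs < G xs)"
proof -
  \<comment> \<open>Nested truncated subtraction sends a positive difference to 1 and 0 to
    0.\<close>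
  have "recursive k (\<lambda>xs. 1 - (1 - (G xs - F xs)))"
    by (intro recursive_diff recursive_const assms)
  then show ?thesis unfolding decidable_def by (rule recursive_cong) auto
qed

lemma decidable_not: "decidable k P \<Longrightarrow> decidable k (\<lambda>xs. \<not> P xs)"
  unfolding decidable_def
  by (rule recursive_cong[OF recursive_diff[of k "\<lambda>xs. 1" "\<lambda>xs. of_bool (P xs)"]])
    (auto intro: recursive_const)

lemma decidable_conj: "decidable k P \<Longrightarrow> decidable k Q \<Longrightarrow> decidable k (\<lambda>xs. P xs \<and> Q xs)"
  unfolding decidable_def
  by (rule recursive_cong[OF recursive_mult[of k "\<lambda>xs. of_bool (P xs)" "\<lambda>xs. of_bool (Q xs)"]]) auto

lemma decidable_disj:
  assumes "decidable k P" and "decidable k Q"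
  shows "decidable k (\<lambda>xs. P xs \<or> Q xs)"
  using decidable_not[OF decidable_conj[OF decidable_not[OF assms(1)] decidable_not[OF assms(2)]]]
  by simp

lemma decidable_imp:
  "decidable k P \<Longrightarrow> decidable k Q \<Longrightarrow> decidable k (\<lambda>xs. P xs \<longrightarrow> Q xs)"
  by (rule decidable_cong[OF decidable_disj[OF decidable_not, of k P Q]]) auto

lemma decidable_le:
  "recursive k F \<Longrightarrow> recursive k G \<Longrightarrow> decidable k (\<lambda>xs. F xs \<le> G xs)"
  using decidable_not[OF decidable_less, of k G F] by (simp add: not_less)

lemma decidable_eq:
  "recursive k F \<Longrightarrow> recursive k G \<Longrightarrow> decidable k (\<lambda>xs. F xs = G xs)"
  by (rule decidable_cong[OF decidable_conj[OF decidable_le decidable_le, of k F G G F]]) auto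

text \<open>A primitive recursion on the bound accumulates the truth value of the disjunction over
  the arguments already passed.\<close>

lemma decidable_bex:
  assumes B: "recursive k B" and P: "decidable (Suc k) (\<lambda>ys. P (hd ys) (tl ys))"
  shows "decidable k (\<lambda>xs. \<exists>z<B xs. P z xs)"
proof -
  \<comment> \<open>The recursion passes on counter, accumulator and parameters; \<open>?j\<close>
    skips the accumulator, which sits at position 1.\<close>
  let ?j = "\<lambda>i. if i = 0 then 0 else Suc i"
  have "recursive (Suc (Suc k)) (\<lambda>ws. of_bool (P (hd (map (\<lambda>i. ws ! ?j i) [0..<Suc k]))
      (tl (map (\<lambda>i. ws ! ?j i) [0..<Suc k]))))"
    by (rule recursive_select[OF P[unfolded decidable_def]]) auto
  then have "recursive (Suc (Suc k)) (\<lambda>ws. of_bool (P (hd ws) (tl (tl ws))))"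
  proof (rule recursive_cong)
    fix ws :: "nat list" assume ws: "length ws = Suc (Suc k)"
    have "map (\<lambda>i. ws ! ?j i) [0..<Suc k] = hd ws # tl (tl ws)"
    proof (rule nth_equalityI)
      fix i assume "i < length (map (\<lambda>i. ws ! ?j i) [0..<Suc k])"
      then show "map (\<lambda>i. ws ! ?j i) [0..<Suc k] ! i = (hd ws # tl (tl ws)) ! i"
        using ws by (cases i) (auto simp: length_Suc_conv simp del: upt_Suc)
    qed (use ws in auto)
    then show "of_bool (P (hd (map (\<lambda>i. ws ! ?j i) [0..<Suc k]))
      (tl (map (\<lambda>i. ws ! ?j i) [0..<Suc k]))) = (of_bool (P (hd ws) (tl (tl ws))) :: nat)"
      by (simp only: list.sel)
  qed
  then have "decidable (Suc (Suc k)) (\<lambda>ws. 0 < hd (tl ws) \<or> P (hd ws) (tl (tl ws)))"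
    by (intro decidable_disj decidable_less recursive_const recursive_vars)
      (simp_all add: decidable_def)
  then have "recursive (Suc k) (\<lambda>xs. rec_nat 0
      (\<lambda>n y. of_bool (0 < hd (tl (n # y # tl xs)) \<or> P (hd (n # y # tl xs))
        (tl (tl (n # y # tl xs))))) (hd xs))"
    unfolding decidable_def by (intro recursive_rec_nat recursive_const)
  from recursive_apply[OF this B] show ?thesis
    unfolding decidable_def
  proof (rule recursive_cong)
    fix xs :: "nat list"
    have "rec_nat 0 (\<lambda>n y. of_bool (0 < y \<or> P n xs)) b = (of_bool (\<exists>z<b. P z xs) :: nat)" for b
      by (induction b) (auto simp: less_Suc_eq)
    then show "rec_nat 0 (\<lambda>n y. of_bool (0 < hd (tl (n # y # tl (B xs # xs)))
        \<or> P (hd (n # y # tl (B xs # xs))) (tl (tl (n # y # tl (B xs # xs)))))) (hd (B xs # xs))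
      = (of_bool (\<exists>z<B xs. P z xs) :: nat)" by simp
  qed
qed

lemma decidable_ball:
  assumes "recursive k B" and "decidable (Suc k) (\<lambda>ys. P (hd ys) (tl ys))"
  shows "decidable k (\<lambda>xs. \<forall>z<B xs. P z xs)"
  using decidable_not[OF decidable_bex[OF assms(1) decidable_not[OF assms(2)]]] by simp

text \<open>\<open>Mu\<close> looks for a zero, so it is applied to the characteristic function of
  the negation. Determinism then yields the exact graph of the search.\<close>

lemma computes_least:
  assumes "decidable (Suc k) P"
  obtains p where "\<And>xs z. length xs = k \<Longrightarrow>
    computes p xs z \<longleftrightarrow> P (z # xs) \<and> (\<forall>m<z. \<not> P (m # xs))"
proof -
  obtain q where q: "\<And>xs. length xs = Suc k \<Longrightarrow> computes q xs (of_bool (\<not> P xs))"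
    using decidable_not[OF assms] unfolding decidable_def recursive_def by blast
  have "computes (Mu q) xs z \<longleftrightarrow> P (z # xs) \<and> (\<forall>m<z. \<not> P (m # xs))" if "length xs = k" for xs z
  proof
    assume "computes (Mu q) xs z"
    then show "P (z # xs) \<and> (\<forall>m<z. \<not> P (m # xs))"
    proof cases
      case Mu
      have v: "y = of_bool (\<not> P (m # xs))" if "computes q (m # xs) y" for m y
        using computes_deterministic[OF that q] \<open>length xs = k\<close> by simp
      show ?thesis using v[OF Mu(1)] Mu(2) v by fastforce
    qed
  next
    assume P: "P (z # xs) \<and> (\<forall>m<z. \<not> P (m # xs))"
    show "computes (Mu q) xs z"
    proof (rule computes.Mu)
      show "computes q (z # xs) 0" using q[of "z # xs"] P that by simp
      show "\<exists>y>0. computes q (m # xs) y" if "m < z" for m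
        using q[of "m # xs"] P that \<open>length xs = k\<close> by (intro exI[of _ 1]) simp
    qed
  qed
  then show thesis by (rule that)
qed

text \<open>The search for the value of a total function always ends. Division and the decoding
  functions are obtained this way.\<close>

lemma recursive_graph:
  assumes "decidable (Suc k) (\<lambda>ys. hd ys = F (tl ys))"
  shows "recursive k F"
proof -
  obtain p where "\<And>xs z. length xs = k \<Longrightarrow> computes p xs z \<longleftrightarrow> z = F xs \<and> (\<forall>m<z. m \<noteq> F xs)"
    using computes_least[OF assms] by auto
  then show ?thesis by (intro recursiveI[of k p]) auto
qed

text \<open>The search for a witness halts exactly when one exists; this supplies the semidecision
  procedures below.\<close>

lemma halting_ex:
  assumes "decidable (Suc k) P"
  shows "\<exists>p. \<forall>xs. length xs = k \<longrightarrow> ((\<exists>z. computes p xs z) \<longleftrightarrow> (\<exists>z. P (z # xs)))"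
proof -
  obtain p where p: "\<And>xs z. length xs = k \<Longrightarrow>
      computes p xs z \<longleftrightarrow> P (z # xs) \<and> (\<forall>m<z. \<not> P (m # xs))"
    using computes_least[OF assms] by blast
  have "(\<exists>z. computes p xs z) \<longleftrightarrow> (\<exists>z. P (z # xs))" if "length xs = k" for xs
    using p[OF that] exists_least_iff[of "\<lambda>z. P (z # xs)"] by auto
  then show ?thesis by blast
qed

lemmas recursive_basic = recursive_vars recursive_const recursive_Suc recursive_add recursive_mult
  recursive_diff recursive_power2
lemmas decidable_basic = decidable_less decidable_le decidable_eq decidable_not decidable_conj
  decidable_disj decidable_imp decidable_bex decidable_ball

lemma recursive_div:
  assumes "recursive k F" and "recursive k G"
  shows "recursive k (\<lambda>xs. F xs div G xs)"
proof (rule recursive_binary[OF _ assms], rule recursive_graph)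
  \<comment> \<open>The first disjunct reflects that division by zero gives 0; the second is false
    for \<open>b = 0\<close>.\<close>
  have eq: "z = a div b \<longleftrightarrow> b = 0 \<and> z = 0 \<or> z * b \<le> a \<and> a < Suc z * b" for z a b :: nat
    by (cases "b = 0") (auto simp: div_nat_eqI mult.commute dest: dividend_less_times_div[of b a])
  show "decidable (Suc 2) (\<lambda>ys. hd ys = tl ys ! 0 div tl ys ! 1)"
    unfolding eq by (intro decidable_basic recursive_basic) simp_all
qed

section \<open>Coding\<close>

definition nfst :: "nat \<Rightarrow> nat" where "nfst w = fst (prod_decode w)"
definition nsnd :: "nat \<Rightarrow> nat" where "nsnd w = snd (prod_decode w)"

lemma nfst_prod_encode [simp]: "nfst (prod_encode (a, b)) = a"
  and nsnd_prod_encode [simp]: "nsnd (prod_encode (a, b)) = b"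
  by (simp_all add: nfst_def nsnd_def)

lemma prod_encode_nfst_nsnd [simp]: "prod_encode (nfst w, nsnd w) = w"
  by (simp add: nfst_def nsnd_def)

lemma nfst_le: "nfst w \<le> w" and nsnd_le: "nsnd w \<le> w"
  using le_prod_encode_1[of "nfst w" "nsnd w"] le_prod_encode_2[of "nsnd w" "nfst w"] by simp_all

lemma recursive_prod_encode:
  assumes "recursive k F" and "recursive k G"
  shows "recursive k (\<lambda>xs. prod_encode (F xs, G xs))"
  unfolding prod_encode_def triangle_def prod.case
  by (intro recursive_basic recursive_div assms)

lemma recursive_nfst:
  assumes "recursive k F"
  shows "recursive k (\<lambda>xs. nfst (F xs))"
proof (rule recursive_unary[OF _ assms], rule recursive_graph)
  have eq: "z = nfst w \<longleftrightarrow> (\<exists>b<Suc w. prod_encode (z, b) = w)" for z w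
    using nsnd_le[of w] by (auto simp: less_Suc_eq_le intro: exI[of _ "nsnd w"])
  show "decidable (Suc 1) (\<lambda>ys. hd ys = nfst (tl ys ! 0))"
    unfolding eq by (intro decidable_basic recursive_basic recursive_prod_encode) simp_all
qed

lemma recursive_nsnd:
  assumes "recursive k F"
  shows "recursive k (\<lambda>xs. nsnd (F xs))"
proof (rule recursive_unary[OF _ assms], rule recursive_graph)
  have eq: "z = nsnd w \<longleftrightarrow> (\<exists>b<Suc w. prod_encode (b, z) = w)" for z w
    using nfst_le[of w] by (auto simp: less_Suc_eq_le intro: exI[of _ "nfst w"])
  show "decidable (Suc 1) (\<lambda>ys. hd ys = nsnd (tl ys ! 0))"
    unfolding eq by (intro decidable_basic recursive_basic recursive_prod_encode) simp_all
qed

lemma decidable_mem_set_decode: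
  assumes "recursive k F" and "recursive k G"
  shows "decidable k (\<lambda>xs. F xs \<in> set_decode (G xs))"
proof -
  \<comment> \<open>The right side says that \<open>b div 2 ^ a\<close> is odd, so that bit
    \<open>a\<close> of \<open>b\<close> is set.\<close>
  have eq: "a \<in> set_decode b \<longleftrightarrow> 2 * (b div 2 ^ a div 2) < b div 2 ^ a" for a b
    unfolding set_decode_def by (auto elim!: oddE)
  show ?thesis unfolding eq by (intro decidable_basic recursive_basic recursive_div assms)
qed

text \<open>An element \<open>a\<close> contributes \<open>2 ^ a\<close> to the code. This bounds
  the quantifiers over members of a coded finite set.\<close>

lemma less_of_mem_set_decode: "a \<in> set_decode b \<Longrightarrow> a < b"
proof -
  assume "a \<in> set_decode b"
  then have "2 ^ a \<le> b" unfolding set_decode_def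
    by (metis (mono_tags, lifting) div_less even_zero linorder_not_less mem_Collect_eq)
  then show "a < b" using less_exp[of a] by linarith
qed

text \<open>The value of \<open>list_encode\<close> on a nonempty list; 0 codes the empty list. Head
  and tail of 0 are default values, so \<open>step\<close> guards them by positivity.\<close>

abbreviation ncons :: "nat \<Rightarrow> nat \<Rightarrow> nat" where "ncons a x \<equiv> Suc (prod_encode (a, x))"

definition nhd :: "nat \<Rightarrow> nat" where "nhd x = nfst (x - 1)"
definition ntl :: "nat \<Rightarrow> nat" where "ntl x = nsnd (x - 1)"

lemma nhd_ncons [simp]: "nhd (ncons a x) = a"
  and ntl_ncons [simp]: "ntl (ncons a x) = x"
  by (simp_all add: nhd_def ntl_def)

lemma list_encode_pos [simp]: "0 < list_encode xs \<longleftrightarrow> xs \<noteq> []"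
  by (cases xs) simp_all

lemma recursive_nhd: "recursive k F \<Longrightarrow> recursive k (\<lambda>xs. nhd (F xs))"
  unfolding nhd_def by (intro recursive_nfst recursive_basic)

lemma recursive_ntl: "recursive k F \<Longrightarrow> recursive k (\<lambda>xs. ntl (F xs))"
  unfolding ntl_def by (intro recursive_nsnd recursive_basic)

lemmas recursive_coding =
  recursive_prod_encode recursive_nfst recursive_nsnd recursive_nhd recursive_ntl

section \<open>Kleene's normal form\<close>

fun code :: "recf \<Rightarrow> nat" and codes :: "recf list \<Rightarrow> nat" where
  "code Zero = prod_encode (0, 0)"
| "code Succ = prod_encode (1, 0)"
| "code (Proj i) = prod_encode (2, i)"
| "code (Comp f gs) = prod_encode (3, prod_encode (code f, codes gs))"
| "code (PrimRec f g) = prod_encode (4, prod_encode (code f, code g))"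
| "code (Mu f) = prod_encode (6, code f)"
| "codes [] = prod_encode (7, 0)"
| "codes (g # gs) = prod_encode (8, prod_encode (code g, codes gs))"

text \<open>
  One rule of an inference system for triples \<open>(program code, argument, result)\<close>, with premises
  in \<open>P\<close>. Tag \<open>5\<close> codes the auxiliary program which on \<open>n # xs\<close> yields \<open>0\<close> if \<open>f\<close> is defined and
  positive on \<open>m # xs\<close> for all \<open>m < n\<close>, as needed for \<open>Mu f\<close>; tags \<open>7\<close> and \<open>8\<close> code lists of programs,
  whose results are codes of lists.
\<close>
definition step :: "(nat \<Rightarrow> nat \<Rightarrow> nat \<Rightarrow> bool) \<Rightarrow> nat \<Rightarrow> nat \<Rightarrow> nat \<Rightarrow> bool" where
  "step P c x y \<longleftrightarrow>
     nfst c = 0 \<and> y = 0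
   \<or> nfst c = 1 \<and> 0 < x \<and> y = Suc (nhd x)
   \<or> nfst c = 2 \<and> nsnd c = 0 \<and> 0 < x \<and> y = nhd x
   \<or> nfst c = 2 \<and> 0 < nsnd c \<and> 0 < x \<and> P (prod_encode (2, nsnd c - 1)) (ntl x) y
   \<or> nfst c = 3 \<and> (\<exists>z. P (nsnd (nsnd c)) x z \<and> P (nfst (nsnd c)) z y)
   \<or> nfst c = 4 \<and> 0 < x \<and> nhd x = 0 \<and> P (nfst (nsnd c)) (ntl x) y
   \<or> nfst c = 4 \<and> 0 < x \<and> 0 < nhd x \<and>
      (\<exists>z. P c (ncons (nhd x - 1) (ntl x)) z \<and>
        P (nsnd (nsnd c)) (ncons (nhd x - 1) (ncons z (ntl x))) y)
   \<or> nfst c = 5 \<and> 0 < x \<and> nhd x = 0 \<and> y = 0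
   \<or> nfst c = 5 \<and> 0 < x \<and> 0 < nhd x \<and> y = 0 \<and>
      (\<exists>z. P (nsnd c) (ncons (nhd x - 1) (ntl x)) z \<and> 0 < z \<and>
        P c (ncons (nhd x - 1) (ntl x)) 0)
   \<or> nfst c = 6 \<and> P (nsnd c) (ncons y x) 0 \<and> P (prod_encode (5, nsnd c)) (ncons y x) 0
   \<or> nfst c = 7 \<and> y = 0
   \<or> nfst c = 8 \<and> 0 < y \<and> P (nfst (nsnd c)) x (nhd y) \<and> P (nsnd (nsnd c)) x (ntl y)"

abbreviation triple :: "nat \<Rightarrow> nat \<Rightarrow> nat \<Rightarrow> nat" where
  "triple c x y \<equiv> prod_encode (c, prod_encode (x, y))"

text \<open>A finite set of this kind is a derivation whose order has been forgotten: every member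
  has the premises of some rule for it inside the set.\<close>

definition closed :: "nat set \<Rightarrow> bool" where
  "closed D \<longleftrightarrow> (\<forall>t\<in>D. step (\<lambda>c x y. triple c x y \<in> D) (nfst t) (nfst (nsnd t)) (nsnd (nsnd t)))"

definition derivable :: "nat \<Rightarrow> nat \<Rightarrow> nat \<Rightarrow> bool" where
  "derivable c x y \<longleftrightarrow> (\<exists>D. finite D \<and> closed D \<and> triple c x y \<in> D)"

lemma step_mono: "step P c x y \<Longrightarrow> (\<And>c x y. P c x y \<Longrightarrow> Q c x y) \<Longrightarrow> step Q c x y"
  unfolding step_def by (elim disj_forward conj_forward ex_forward)

lemma closed_Un: "closed D \<Longrightarrow> closed E \<Longrightarrow> closed (D \<union> E)"
  unfolding closed_def
  by (intro ballI, elim UnE; drule (1) bspec, erule step_mono, simp)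

lemma derivableE:
  assumes "derivable c x y"
  obtains D where "finite D" "closed D" "triple c x y \<in> D"
  using assms unfolding derivable_def by blast

lemma derivable_pair:
  assumes "derivable c x y" and "derivable c' x' y'"
  obtains D where "finite D" "closed D" "triple c x y \<in> D" "triple c' x' y' \<in> D"
  using assms unfolding derivable_def by (metis UnCI closed_Un finite_Un)

text \<open>Every rule has at most two premises, so a union of two closed sets serves. The twelve
  subgoals follow the disjuncts of \<open>step\<close>.\<close>

lemma step_derivable_finite:
  assumes "step derivable c x y"
  obtains D where "finite D" "closed D" "step (\<lambda>c x y. triple c x y \<in> D) c x y"
proof -
  have 0: "finite {}" "closed {}" unfolding closed_def by simp_all
  show thesis using assms unfolding step_def[of derivable]
    apply (elim disjE conjE exE)
    subgoal by (rule that[OF 0]) (simp add: step_def)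
    subgoal by (rule that[OF 0]) (simp add: step_def)
    subgoal by (rule that[OF 0]) (simp add: step_def)
    subgoal by (erule derivableE, rule that, assumption, assumption) (simp add: step_def; blast)
    subgoal by (erule (1) derivable_pair, rule that, assumption, assumption) (simp add: step_def; blast)
    subgoal by (erule derivableE, rule that, assumption, assumption) (simp add: step_def; blast)
    subgoal by (erule (1) derivable_pair, rule that, assumption, assumption) (simp add: step_def; blast)
    subgoal by (rule that[OF 0]) (simp add: step_def)
    subgoal by (erule (1) derivable_pair, rule that, assumption, assumption) (simp add: step_def; blast)
    subgoal by (erule (1) derivable_pair, rule that, assumption, assumption) (simp add: step_def; blast)
    subgoal by (rule that[OF 0]) (simp add: step_def)
    subgoal by (erule (1) derivable_pair, rule that, assumption, assumption) (simp add: step_def; blast)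
    done
qed

lemma closed_insert:
  assumes "closed D" and "step (\<lambda>c x y. triple c x y \<in> D) c x y"
  shows "closed (insert (triple c x y) D)"
  unfolding closed_def
proof
  fix t assume "t \<in> insert (triple c x y) D"
  then consider "t = triple c x y" | "t \<in> D" by (rule insertE)
  then have "step (\<lambda>c x y. triple c x y \<in> D) (nfst t) (nfst (nsnd t)) (nsnd (nsnd t))"
  proof cases
    case 1
    show ?thesis unfolding 1 nfst_prod_encode nsnd_prod_encode by (rule assms(2))
  next
    case 2
    show ?thesis by (rule bspec[OF assms(1)[unfolded closed_def] 2])
  qed
  then show "step (\<lambda>c' x' y'. triple c' x' y' \<in> insert (triple c x y) D)
      (nfst t) (nfst (nsnd t)) (nsnd (nsnd t))"
    by (rule step_mono) (rule insertI2)
qed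

text \<open>Turns each disjunct of \<open>step\<close> into an introduction rule, by adding the
  conclusion to a closed set that holds the premises.\<close>

lemma derivable_step:
  assumes "step derivable c x y"
  shows "derivable c x y"
proof -
  obtain D where D: "finite D" "closed D" "step (\<lambda>c x y. triple c x y \<in> D) c x y"
    using step_derivable_finite[OF assms] .
  show ?thesis unfolding derivable_def
    using D(1) closed_insert[OF D(2,3)] by (intro exI[of _ "insert (triple c x y) D"]) simp
qed

lemma derivable_Proj:
  "i < length xs \<Longrightarrow> derivable (prod_encode (2, i)) (list_encode xs) (xs ! i)"
proof (induction i arbitrary: xs)
  case 0
  then show ?case by (intro derivable_step) (cases xs; simp add: step_def)
next
  case (Suc i)
  then show ?case by (intro derivable_step) (cases xs; simp add: step_def)
qed

section \<open>Agreement of derivations with computations\<close>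

lemma derivable_of_computes: "computes p xs y \<Longrightarrow> derivable (code p) (list_encode xs) y"
proof (induction rule: computes.induct)
  case (Zero xs)
  show ?case by (rule derivable_step) (simp add: step_def)
next
  case (Succ x xs)
  show ?case by (rule derivable_step) (simp add: step_def)
next
  case (Proj i xs)
  then show ?case by (simp add: derivable_Proj)
next
  case (Comp xs gs ys f z)
  \<comment> \<open>The list of results is derived with tags 7 and 8, by induction along
    \<open>gs\<close> and \<open>ys\<close>.\<close>
  from Comp.IH(1) have "derivable (codes gs) (list_encode xs) (list_encode ys)"
    by (induction rule: list_all2_induct) (auto intro!: derivable_step simp: step_def)
  with Comp.IH(2) show ?case by (intro derivable_step) (auto simp: step_def)
next
  case (PrimRec_0 f xs y g)
  then show ?case by (intro derivable_step) (simp add: step_def)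
next
  case (PrimRec_Suc f g n xs y z)
  then show ?case by (intro derivable_step) (auto simp: step_def)
next
  case (Mu f n xs)
  \<comment> \<open>At \<open>m = n\<close> this is the second premise of the rule for
    \<open>Mu\<close>.\<close>
  have "derivable (prod_encode (5, code f)) (ncons m (list_encode xs)) 0" if "m \<le> n" for m
    using that
  proof (induction m)
    case 0
    show ?case by (rule derivable_step) (simp add: step_def)
  next
    case (Suc m)
    then obtain y where "0 < y" "derivable (code f) (ncons m (list_encode xs)) y"
      using Mu.IH(2)[of m] by auto
    with Suc show ?case by (intro derivable_step) (auto simp: step_def)
  qed
  with Mu.IH(1) show ?case by (intro derivable_step) (simp add: step_def)
qed

lemma closedD: "closed D \<Longrightarrow> triple c x y \<in> D \<Longrightarrow> step (\<lambda>c x y. triple c x y \<in> D) c x y"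
  unfolding closed_def by (drule (1) bspec) simp

text \<open>
  The premises of each rule concern smaller programs or a smaller recursion argument, so no
  well-foundedness has to be built into \<open>closed\<close>.
\<close>
lemma computes_of_closed:
  assumes D: "closed D"
  shows "triple (code p) (list_encode xs) y \<in> D \<Longrightarrow> computes p xs y"
    and "triple (codes ps) (list_encode xs) v \<in> D \<Longrightarrow>
      \<exists>ys. v = list_encode ys \<and> list_all2 (\<lambda>g y. computes g xs y) ps ys"
proof (induction p and ps arbitrary: xs y and xs v rule: code_codes.induct)
  case 1
  from closedD[OF D 1] show ?case by (simp add: step_def computes.Zero)
next
  case 2
  from closedD[OF D 2] show ?case by (cases xs) (simp_all add: step_def computes.Succ)
next
  case (3 i)
  have "i < length xs \<and> y = xs ! i" using 3
  proof (induction i arbitrary: xs)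
    case 0
    from closedD[OF D 0[simplified]] show ?case by (cases xs) (simp_all add: step_def)
  next
    case (Suc i)
    from closedD[OF D Suc.prems[simplified]] obtain x r where xs: "xs = x # r"
      and "triple (prod_encode (2, i)) (list_encode r) y \<in> D"
      by (cases xs) (simp_all add: step_def)
    with Suc.IH[of r] show ?case by simp
  qed
  then show ?case by (simp add: computes.Proj)
next
  case (4 f gs)
  from closedD[OF D 4(3)[simplified]] obtain z
    where z: "triple (codes gs) (list_encode xs) z \<in> D" and y: "triple (code f) z y \<in> D"
    by (auto simp: step_def)
  from 4(2)[OF z] obtain ys where "z = list_encode ys"
    and "list_all2 (\<lambda>g y. computes g xs y) gs ys" by blast
  with 4(1) y show ?case by (blast intro: computes.Comp)
next
  case (5 f g)
  let ?c = "prod_encode (4, prod_encode (code f, code g))"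
  \<comment> \<open>The successor rule calls the same program again, which the induction on programs
    does not cover; the recursion argument decreases instead.\<close>
  have *: "triple ?c (list_encode (n # r)) y \<in> D \<Longrightarrow> computes (PrimRec f g) (n # r) y" for n r y
  proof (induction n arbitrary: y)
    case 0
    from closedD[OF D 0] have "triple (code f) (list_encode r) y \<in> D" by (simp add: step_def)
    then show ?case by (intro computes.PrimRec_0 5(1))
  next
    case (Suc n)
    from closedD[OF D Suc.prems] obtain z where "triple ?c (list_encode (n # r)) z \<in> D"
      and "triple (code g) (list_encode (n # z # r)) y \<in> D"
      by (auto simp: step_def)
    then show ?case by (blast intro: computes.PrimRec_Suc Suc.IH 5(2))
  qed
  from closedD[OF D 5(3)[simplified]] have "xs \<noteq> []" by (auto simp: step_def)
  with * 5(3) show ?case by (auto simp del: list_encode.simps simp: neq_Nil_conv)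
next
  case (6 f)
  \<comment> \<open>Unfolding the tag 5 rule downwards from \<open>n\<close> reaches every smaller
    \<open>m\<close>.\<close>
  have *: "triple (prod_encode (5, code f)) (list_encode (n # xs)) v \<in> D \<Longrightarrow>
      m < n \<Longrightarrow> \<exists>y>0. computes f (m # xs) y" for n m v
  proof (induction n arbitrary: v)
    case (Suc n)
    from closedD[OF D Suc.prems(1)] obtain z where "0 < z"
      and "triple (code f) (list_encode (n # xs)) z \<in> D"
      and "triple (prod_encode (5, code f)) (list_encode (n # xs)) 0 \<in> D"
      by (auto simp: step_def)
    then show ?case using Suc.IH Suc.prems(2) 6(1) by (metis less_SucE)
  qed simp
  from closedD[OF D 6(2)[simplified]]
  have "triple (code f) (list_encode (y # xs)) 0 \<in> D"
    and "triple (prod_encode (5, code f)) (list_encode (y # xs)) 0 \<in> D"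
    by (simp_all add: step_def)
  then show ?case by (blast intro: computes.Mu 6(1) *)
next
  case 7
  from closedD[OF D 7[simplified]] show ?case by (auto simp: step_def intro!: exI[of _ "[]"])
next
  case (8 g gs)
  from closedD[OF D 8(3)[simplified]] have "0 < v"
    and g: "triple (code g) (list_encode xs) (nhd v) \<in> D"
    and gs: "triple (codes gs) (list_encode xs) (ntl v) \<in> D"
    by (auto simp: step_def)
  then have v: "v = ncons (nhd v) (ntl v)" by (simp add: nhd_def ntl_def)
  from 8(2)[OF gs] obtain ys where "ntl v = list_encode ys"
    and "list_all2 (\<lambda>g y. computes g xs y) gs ys" by blast
  with 8(1)[OF g] v show ?case by (intro exI[of _ "nhd v # ys"]) simp
qed

text \<open>A form of Kleene's T predicate: \<open>d\<close> codes a finite set that serves as the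
  computation history.\<close>

definition accepts :: "nat \<Rightarrow> nat \<Rightarrow> nat \<Rightarrow> bool" where
  "accepts d c x \<longleftrightarrow> closed (set_decode d) \<and> (\<exists>y. triple c x y \<in> set_decode d)"

lemma halting_iff_accepts:
  "(\<exists>y. computes p xs y) \<longleftrightarrow> (\<exists>d. accepts d (code p) (list_encode xs))"
proof
  assume "\<exists>y. computes p xs y"
  then obtain y where "derivable (code p) (list_encode xs) y"
    using derivable_of_computes by blast
  then obtain D where "finite D" "closed D" "triple (code p) (list_encode xs) y \<in> D"
    unfolding derivable_def by blast
  then have "accepts (set_encode D) (code p) (list_encode xs)"
    unfolding accepts_def by auto
  then show "\<exists>d. accepts d (code p) (list_encode xs)" ..
next
  assume "\<exists>d. accepts d (code p) (list_encode xs)"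
  then show "\<exists>y. computes p xs y"
    unfolding accepts_def using computes_of_closed(1) by blast
qed

text \<open>The pairing function dominates its arguments and a code exceeds its members, so every
  witness is below \<open>d\<close>.\<close>

lemma ex_triple_bounded:
  "(\<exists>z. triple c x z \<in> set_decode d \<and> P z) \<longleftrightarrow> (\<exists>z<d. triple c x z \<in> set_decode d \<and> P z)"
  by (meson le_prod_encode_2 le_less_trans less_of_mem_set_decode)

lemma closed_bounded:
  "closed (set_decode d) \<longleftrightarrow> (\<forall>t<d. t \<in> set_decode d \<longrightarrow>
    step (\<lambda>c x y. triple c x y \<in> set_decode d) (nfst t) (nfst (nsnd t)) (nsnd (nsnd t)))"
  unfolding closed_def using less_of_mem_set_decode by blast

lemma decidable_accepts:
  assumes "recursive k F" and "recursive k G" and "recursive k H"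
  shows "decidable k (\<lambda>xs. accepts (F xs) (G xs) (H xs))"
proof -
  have "decidable 3 (\<lambda>xs. accepts (xs ! 0) (xs ! 1) (xs ! 2))"
    unfolding accepts_def closed_bounded step_def
      ex_triple_bounded ex_triple_bounded[where P = "\<lambda>z. True", simplified]
    by (intro decidable_basic decidable_mem_set_decode recursive_basic recursive_coding) simp_all
  with recursive_compose[of "[F, G, H]" "\<lambda>xs. of_bool (accepts (xs ! 0) (xs ! 1) (xs ! 2))" k]
  show ?thesis using assms by (auto simp: decidable_def numeral_3_eq_3 numeral_2_eq_2)
qed

section \<open>The preorder\<close>

definition self_halting :: "nat set" where
  "self_halting = {e. \<exists>d. accepts d e (list_encode [e])}"

text \<open>Diagonalization: at \<open>n = code p\<close> the equivalence contradicts
  itself.\<close>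

lemma self_halting_not_co_ce: "\<not> (\<forall>n. (\<exists>z. computes p [n] z) \<longleftrightarrow> n \<notin> self_halting)"
  unfolding halting_iff_accepts self_halting_def by blast

text \<open>Iterates a search for a next state \<open>w\<close> after \<open>s\<close>. The program
  tests only \<open>C\<close>; the possibly undecidable invariant \<open>I\<close> guarantees that
  each search succeeds.\<close>

lemma recursive_sequence:
  assumes C: "decidable 2 (\<lambda>xs. C (xs ! 0) (xs ! 1))"
    and base: "I 0 s"
    and ex: "\<And>n s. I n s \<Longrightarrow> \<exists>w. C w s"
    and next_state: "\<And>n s w. I n s \<Longrightarrow> C w s \<Longrightarrow> I (Suc n) w"
  obtains \<sigma> where "recursive 1 (\<lambda>xs. \<sigma> (xs ! 0))" and "\<And>n. I n (\<sigma> n)"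
proof -
  from C have "decidable (Suc 1) (\<lambda>xs. C (xs ! 0) (xs ! 1))"
    by (simp only: numeral_2_eq_2 One_nat_def)
  then obtain p where "\<And>xs z. length xs = 1 \<Longrightarrow> computes p xs z \<longleftrightarrow>
      C ((z # xs) ! 0) ((z # xs) ! 1) \<and> (\<forall>m<z. \<not> C ((m # xs) ! 0) ((m # xs) ! 1))"
    by (rule computes_least) blast
  from this[of "[_]"] have p: "computes p [s] z \<longleftrightarrow> C z s \<and> (\<forall>m<z. \<not> C m s)" for s z
    by simp
  obtain q where q: "computes q [] s"
    using recursive_const[of 0 s] unfolding recursive_def by auto
  define \<sigma> where "\<sigma> = rec_nat s (\<lambda>n s. LEAST w. C w s)"
  have \<sigma>_0: "\<sigma> 0 = s" and \<sigma>_Suc: "\<sigma> (Suc n) = (LEAST w. C w (\<sigma> n))" for n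
    by (simp_all add: \<sigma>_def)
  have least: "C (LEAST w. C w s) s" if "I n s" for n s
    using ex[OF that] by (rule LeastI_ex)
  have I: "I n (\<sigma> n)" for n
  proof (induction n)
    case (Suc n)
    then show ?case unfolding \<sigma>_Suc using least by (blast intro: next_state)
  qed (simp add: \<sigma>_0 base)
  \<comment> \<open>Off the invariant \<open>p\<close> may diverge, so halting is proved along the
    actual run. \<open>Proj 1\<close> drops the counter and hands over the previous state.\<close>
  have "computes (PrimRec q (Comp p [Proj 1])) [n] (\<sigma> n)" for n
  proof (induction n)
    case 0
    show ?case unfolding \<sigma>_0 by (rule computes.PrimRec_0[OF q])
  next
    case (Suc n)
    have "computes p [\<sigma> n] (\<sigma> (Suc n))"
      using least[OF I] not_less_Least[of _ "\<lambda>w. C w (\<sigma> n)"] unfolding p \<sigma>_Suc by blast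
    moreover have "computes (Proj 1) [n, \<sigma> n] (\<sigma> n)"
      using computes.Proj[of 1 "[n, \<sigma> n]"] by simp
    ultimately have "computes (Comp p [Proj 1]) [n, \<sigma> n] (\<sigma> (Suc n))"
      by (intro computes.Comp[where ys = "[\<sigma> n]"]) simp_all
    with Suc show ?case by (rule computes.PrimRec_Suc)
  qed
  then have "recursive 1 (\<lambda>xs. \<sigma> (xs ! 0))"
    by (intro recursiveI) (auto simp: length_Suc_conv)
  with I show thesis by (intro that)
qed

section \<open>The preorder on pairs and its enumeration\<close>

definition pair_preorder :: "nat set \<Rightarrow> nat rel" where
  "pair_preorder A = {(x, y). x div 2 + 2 \<le> y div 2 \<or>
     x div 2 = y div 2 \<and> (x = y \<or> x div 2 \<in> A)}"

lemma preorder_pair_preorder: "preorder_on UNIV (pair_preorder A)"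
proof -
  have "trans (pair_preorder A)"
  proof (rule transI)
    fix x y z assume "(x, y) \<in> pair_preorder A" and "(y, z) \<in> pair_preorder A"
    then show "(x, z) \<in> pair_preorder A"
      unfolding pair_preorder_def mem_Collect_eq prod.case by (elim disjE conjE) simp_all
  qed
  then show ?thesis by (simp add: preorder_on_def refl_on_def pair_preorder_def)
qed

lemma ce_pair_preorder: "ce (pair_preorder self_halting)"
proof -
  \<comment> \<open>The quantifier over \<open>d\<close> is pulled in front of the whole
    disjunction: the searched \<open>d\<close> is argument 0, and \<open>x\<close>, \<open>y\<close>
    become arguments 1 and 2.\<close>
  have "decidable (Suc 2) (\<lambda>xs. xs ! 1 div 2 + 2 \<le> xs ! 2 div 2 \<or>
      xs ! 1 div 2 = xs ! 2 div 2 \<and>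
      (xs ! 1 = xs ! 2 \<or> accepts (xs ! 0) (xs ! 1 div 2) (ncons (xs ! 1 div 2) 0)))"
    by (intro decidable_basic decidable_accepts recursive_basic recursive_coding recursive_div)
      simp_all
  from halting_ex[OF this] obtain p where p: "\<And>xs. length xs = 2 \<Longrightarrow>
      (\<exists>z. computes p xs z) \<longleftrightarrow> (\<exists>d. xs ! 0 div 2 + 2 \<le> xs ! 1 div 2 \<or>
      xs ! 0 div 2 = xs ! 1 div 2 \<and>
      (xs ! 0 = xs ! 1 \<or> accepts d (xs ! 0 div 2) (ncons (xs ! 0 div 2) 0)))"
    by (auto simp: numeral_2_eq_2)
  have "(x, y) \<in> pair_preorder self_halting \<longleftrightarrow> (\<exists>z. computes p [x, y] z)" for x y
    by (auto simp: p pair_preorder_def self_halting_def)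
  then show ?thesis unfolding ce_def by blast
qed

abbreviation incomparable :: "'a rel \<Rightarrow> 'a \<Rightarrow> 'a \<Rightarrow> bool" where
  "incomparable R x y \<equiv> (x, y) \<notin> R \<and> (y, x) \<notin> R"

text \<open>Whatever \<open>A\<close> is, elements of distinct pairs are incomparable exactly when
  the pairs are adjacent. Excluding the lower neighbour leaves the upper one.\<close>

lemma incomparable_pair_preorder_iff:
  assumes "i \<in> {2 * n + 2, 2 * n + 3}"
  shows "j \<notin> {2 * n, 2 * n + 1, 2 * n + 2, 2 * n + 3} \<and> incomparable (pair_preorder A) i j \<longleftrightarrow>
    j \<in> {2 * n + 4, 2 * n + 5}"
proof -
  have "i div 2 = n + 1" using assms by auto
  then have "incomparable (pair_preorder A) i j \<longleftrightarrow>
      \<not> n + 3 \<le> j div 2 \<and> \<not> j div 2 + 2 \<le> n + 1 \<and> j div 2 \<noteq> n + 1"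
    if "j \<notin> {2 * n + 2, 2 * n + 3}"
    using that assms by (auto simp: pair_preorder_def)
  then show ?thesis by auto
qed

theorem theorem3p1:
  "\<exists>R. Sigma01_preorder R \<and> \<not> (\<exists>S. Pi01_preorder S \<and> isomorphic R S)"
proof (intro exI conjI)
  let ?R = "pair_preorder self_halting"
  show "Sigma01_preorder ?R"
    unfolding Sigma01_preorder_def by (intro conjI preorder_pair_preorder ce_pair_preorder)
  show "\<not> (\<exists>S. Pi01_preorder S \<and> isomorphic ?R S)"
  proof
    assume "\<exists>S. Pi01_preorder S \<and> isomorphic ?R S"
    then obtain S h where S: "ce (- S)" and h: "bij h"
      and iso: "\<And>x y. (x, y) \<in> ?R \<longleftrightarrow> (h x, h y) \<in> S"
      unfolding Pi01_preorder_def co_ce_def isomorphic_def by blast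
    from S obtain p where "\<And>x y. (x, y) \<in> - S \<longleftrightarrow> (\<exists>z. computes p [x, y] z)"
      unfolding ce_def by blast
    then have S_iff: "(x, y) \<notin> S \<longleftrightarrow> (\<exists>d. accepts d (code p) (ncons x (ncons y 0)))" for x y
      by (simp add: halting_iff_accepts)
    \<comment> \<open>Decidable approximation by stages to the complement of \<open>S\<close>,
      increasing in \<open>t\<close>.\<close>
    define N where "N t x y \<longleftrightarrow> (\<exists>d<t. accepts d (code p) (ncons x (ncons y 0)))" for t x y
    have N_imp: "(x, y) \<notin> S" if "N t x y" for t x y
      using that unfolding S_iff N_def by blast
    have N_ex: "\<exists>t. \<forall>t'\<ge>t. N t' x y" if "(x, y) \<notin> S" for x y
      using that unfolding S_iff N_def by (meson Suc_le_eq)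

    text \<open>A state codes two consecutive pairs of the copy, and a bound on the search for a
      witness of the incomparabilities.\<close>
    define a where "a s = nfst (nfst s)" for s
    define b where "b s = nsnd (nfst s)" for s
    define u where "u s = nfst (nfst (nsnd s))" for s
    define v where "v s = nsnd (nfst (nsnd s))" for s
    define t where "t s = nsnd (nsnd s)" for s
    note fields = a_def b_def u_def v_def t_def
    \<comment> \<open>Pairs are tracked only as sets, since the search does not control the order in
      which their elements appear.\<close>
    define I where
      "I n s \<longleftrightarrow> {a s, b s} = h ` {2 * n, 2 * n + 1} \<and> {u s, v s} = h ` {2 * n + 2, 2 * n + 3}"
      for n s
    define fresh where
      "fresh k s x \<longleftrightarrow> x \<noteq> a s \<and> x \<noteq> b s \<and> x \<noteq> u s \<and> x \<noteq> v s \<and> N k (u s) x \<and> N k x (u s)"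
      for k s x
    \<comment> \<open>The stage bound belongs to the new state \<open>w\<close>, so \<open>C\<close>
      is decidable while the search over \<open>w\<close> runs through all bounds.\<close>
    define C where
      "C w s \<longleftrightarrow> a w = u s \<and> b w = v s \<and> u w \<noteq> v w \<and> fresh (t w) s (u w) \<and> fresh (t w) s (v w)"
      for w s
    have fresh_iff: "x \<in> h ` {2 * n + 4, 2 * n + 5} \<longleftrightarrow> (\<exists>k. fresh k s x)"
      and fresh_mono: "fresh k s x \<Longrightarrow> k \<le> k' \<Longrightarrow> fresh k' s x"
      if I: "I n s" for n s x k k'
    proof -
      obtain i where i: "i \<in> {2 * n + 2, 2 * n + 3}" "u s = h i"
        using I unfolding I_def by blast
      obtain j where j: "x = h j" using h by (metis bij_pointE)
      have inj: "h x \<in> h ` X \<longleftrightarrow> x \<in> X" for x X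
        using h by (simp add: bij_is_inj inj_image_mem_iff)
      have "(\<exists>k. N k (u s) x \<and> N k x (u s)) \<longleftrightarrow> incomparable S (u s) x"
        using N_imp N_ex[of "u s" x] N_ex[of x "u s"] by (meson nat_le_linear)
      also have "\<dots> \<longleftrightarrow> incomparable ?R i j" by (simp add: iso i j)
      finally have *: "(\<exists>k. N k (u s) x \<and> N k x (u s)) \<longleftrightarrow> incomparable ?R i j" .
      have "x \<noteq> a s \<and> x \<noteq> b s \<and> x \<noteq> u s \<and> x \<noteq> v s \<longleftrightarrow> x \<notin> {a s, b s} \<union> {u s, v s}" by blast
      also have "\<dots> \<longleftrightarrow> x \<notin> h ` {2 * n, 2 * n + 1, 2 * n + 2, 2 * n + 3}"
        using I unfolding I_def by auto
      finally have "(\<exists>k. fresh k s x) \<longleftrightarrow>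
          j \<notin> {2 * n, 2 * n + 1, 2 * n + 2, 2 * n + 3} \<and> incomparable ?R i j"
        unfolding fresh_def j inj using *[unfolded j] by blast
      also have "\<dots> \<longleftrightarrow> j \<in> {2 * n + 4, 2 * n + 5}"
        by (rule incomparable_pair_preorder_iff[OF i(1)])
      finally show "x \<in> h ` {2 * n + 4, 2 * n + 5} \<longleftrightarrow> (\<exists>k. fresh k s x)"
        unfolding j inj by simp
      show "fresh k s x \<Longrightarrow> k \<le> k' \<Longrightarrow> fresh k' s x"
        unfolding fresh_def N_def by (meson less_le_trans)
    qed

    obtain \<sigma> where \<sigma>: "recursive 1 (\<lambda>xs. \<sigma> (xs ! 0))" and I: "\<And>n. I n (\<sigma> n)"
    proof (rule recursive_sequence[where C = C and I = I])
      show "decidable 2 (\<lambda>xs. C (xs ! 0) (xs ! 1))"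
        unfolding C_def fresh_def N_def fields
        by (intro decidable_basic decidable_accepts recursive_basic recursive_coding) simp_all
      \<comment> \<open>The bijection \<open>h\<close> may be noncomputable; only these four values
        enter the program, as a constant. The final 0 is an arbitrary initial bound.\<close>
      show "I 0 (prod_encode (prod_encode (h 0, h 1), prod_encode (prod_encode (h 2, h 3), 0)))"
        by (simp add: I_def fields flip: numeral_2_eq_2)
      show "\<exists>w. C w s" if I: "I n s" for n s
      proof -
        obtain k k' where k: "fresh k s (h (2 * n + 4))" "fresh k' s (h (2 * n + 5))"
          using fresh_iff[OF I] by blast
        have "h (2 * n + 4) \<noteq> h (2 * n + 5)"
          using h by (simp add: bij_is_inj inj_eq)
        \<comment> \<open>The two candidates may become fresh at different stages; monotonicity
          permits the maximum.\<close>
        then have "C (prod_encode (prod_encode (u s, v s),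
            prod_encode (prod_encode (h (2 * n + 4), h (2 * n + 5)), max k k'))) s"
          using fresh_mono[OF I k(1), of "max k k'"] fresh_mono[OF I k(2), of "max k k'"]
          by (simp add: C_def a_def[of "prod_encode _"] b_def[of "prod_encode _"]
              u_def[of "prod_encode _"] v_def[of "prod_encode _"] t_def[of "prod_encode _"])
        then show ?thesis ..
      qed
      show "I (Suc n) w" if "I n s" "C w s" for n s w
      proof -
        have "u w \<in> h ` {2 * n + 4, 2 * n + 5}" "v w \<in> h ` {2 * n + 4, 2 * n + 5}" "u w \<noteq> v w"
          using that(2) fresh_iff[OF that(1)] unfolding C_def by blast+
        then have "{u w, v w} = h ` {2 * n + 4, 2 * n + 5}" by auto
        moreover have "{a w, b w} = h ` {2 * n + 2, 2 * n + 3}"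
          using that unfolding C_def I_def by simp
        ultimately show ?thesis by (simp add: I_def numeral_eq_Suc)
      qed
    qed blast

    \<comment> \<open>The unknown order within the pair is harmless: both directions of the relation
      there are equivalent to halting.\<close>
    have halt: "n \<notin> self_halting \<longleftrightarrow> (a (\<sigma> n), b (\<sigma> n)) \<notin> S" for n
    proof -
      have "(2 * n, 2 * n + 1) \<in> ?R \<longleftrightarrow> n \<in> self_halting"
        and "(2 * n + 1, 2 * n) \<in> ?R \<longleftrightarrow> n \<in> self_halting"
        by (simp_all add: pair_preorder_def)
      moreover have "a (\<sigma> n) = h (2 * n) \<and> b (\<sigma> n) = h (2 * n + 1) \<or>
          a (\<sigma> n) = h (2 * n + 1) \<and> b (\<sigma> n) = h (2 * n)"
        using I[of n] unfolding I_def by (simp add: doubleton_eq_iff)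
      ultimately show ?thesis using iso by metis
    qed
    \<comment> \<open>Feeding the computed pair to the semidecision procedure for the complement of
      \<open>S\<close> enumerates the complement of the halting set.\<close>
    have "decidable (Suc 1)
        (\<lambda>xs. accepts (xs ! 0) (code p) (ncons (a (\<sigma> (xs ! 1))) (ncons (b (\<sigma> (xs ! 1))) 0)))"
      unfolding fields
      by (intro decidable_accepts recursive_basic recursive_coding recursive_unary[OF \<sigma>]) simp_all
    from halting_ex[OF this] obtain q where q: "\<And>xs. length xs = 1 \<Longrightarrow> (\<exists>z. computes q xs z) \<longleftrightarrow>
        (\<exists>z. accepts ((z # xs) ! 0) (code p)
          (ncons (a (\<sigma> ((z # xs) ! 1))) (ncons (b (\<sigma> ((z # xs) ! 1))) 0)))"
      by blast
    have "(\<exists>z. computes q [n] z) \<longleftrightarrow> n \<notin> self_halting" for n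
      unfolding halt S_iff using q[of "[n]"] by simp
    then show False using self_halting_not_co_ce by blast
  qed
qed

end
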